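(* Let $\mathbf{X}_i^{(k)},\mathbf{V}_i^{(k)},\mathbf{U}_i^{(k)}$, $t_0,t_f,\alpha_k$ and multipliers $\boldsymbol\Lambda_{x,i}^{(k)},\boldsymbol\Lambda_{v,i}^{(k)}$ $(i=1,\ldots,N+1)$, $\tilde{\boldsymbol\Lambda}_{v,0}^{(k)},\tilde{\boldsymbol\Lambda}_{v,N+1}^{(k)}$ $(k=1,\ldots,K)$, $\boldsymbol\Psi$, $\Theta$ satisfy the KKT conditions (K1)-(K10) of the modified Legendre-Gauss collocation method listed in the context. For $k=1,\ldots,K$ define the transformed adjoint variables $$\boldsymbol\lambda_{x,0}^{(k)}=\boldsymbol\Lambda_{x,N+1}^{(k)}-\mathbf{D}_{(:,0)}^{\mathsf T}\boldsymbol\Lambda_{x,1:N}^{(k)},\qquad \boldsymbol\lambda_{x,i}^{(k)}=\tfrac{1}{w_i}\boldsymbol\Lambda_{x,i}^{(k)}+\boldsymbol\Lambda_{x,N+1}^{(k)}\ (i=1,\ldots,N),\qquad \boldsymbol\lambda_{x,N+1}^{(k)}=\boldsymbol\Lambda_{x,N+1}^{(k)},$$ $$\boldsymbol\lambda_{v,0}^{(k)}=\boldsymbol\Lambda_{v,N+1}^{(k)}-\mathbf{D}_{(:,0)}^{\mathsf T}\boldsymbol\Lambda_{v,1:N}^{(k)}-\tilde{\mathbf{D}}_{(0,0)}\tilde{\boldsymbol\Lambda}_{v,0}^{(k)}-\tilde{\mathbf{D}}_{(N+1,0)}\tilde{\boldsymbol\Lambda}_{v,N+1}^{(k)},$$ $$\boldsymbol\lambda_{v,i}^{(k)}=\tfrac{1}{w_i}\boldsymbol\Lambda_{v,i}^{(k)}+\boldsymbol\Lambda_{v,N+1}^{(k)}-\mathbf{L}_{(0,i)}\tilde{\boldsymbol\Lambda}_{v,0}^{(k)}+\mathbf{L}_{(N+1,i)}\tilde{\boldsymbol\Lambda}_{v,N+1}^{(k)}\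 (i=1,\ldots,N),\qquad \boldsymbol\lambda_{v,N+1}^{(k)}=\boldsymbol\Lambda_{v,N+1}^{(k)},\qquad \boldsymbol\psi=\boldsymbol\Psi .$$ Let $\mathbf{D}^{\dagger}$ be the $N\times(N+1)$ matrix (rows $1,\ldots,N$, columns $1,\ldots,N+1$) with $$\mathbf{D}^{\dagger}_{(i,j)}=-\frac{w_j}{w_i}\mathbf{D}_{(j,i)}\quad(i,j=1,\ldots,N),\qquad \mathbf{D}^{\dagger}_{(i,N+1)}=\sum_{j=1}^N\frac{w_j}{w_i}\mathbf{D}_{(j,i)}\quad(i=1,\ldots,N).$$ Then the following transformed adjoint system holds: for all $i=1,\ldots,N$ and $k=1,\ldots,K$, $$\sum_{j=1}^{N+1}\mathbf{D}^{\dagger}_{(i,j)}\boldsymbol\lambda_{x,j}^{(k)}=-\frac{t_f-t_0}{2}\alpha_k\nabla_{\mathbf{X}_i}\bar{\mathcal H}_i^{(k)},\qquad \sum_{j=1}^{N+1}\mathbf{D}^{\dagger}_{(i,j)}\boldsymbol\lambda_{v,j}^{(k)}=-\frac{t_f-t_0}{2}\alpha_k\nabla_{\mathbf{V}_i}\bar{\mathcal H}_i^{(k)},\qquad \mathbf{0}=\frac{t_f-t_0}{2}\alpha_k\nabla_{\mathbf{U}_i}\bar{\mathcal H}_i^{(k)},$$ and $$\boldsymbol\lambda_{x,0}^{(1)}=-\nabla_{\mathbf{X}_0}\mathcal M+\nabla_{\mathbf{X}_0}(\boldsymbol\psi\mathbf b^{\mathsf T}),\qquad \boldsymbol\lambda_{v,0}^{(1)}=-\nabla_{\mathbf{V}_0}\mathcal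 M+\nabla_{\mathbf{V}_0}(\boldsymbol\psi\mathbf b^{\mathsf T}),$$ $$\boldsymbol\lambda_{x,N+1}^{(K)}=\nabla_{\mathbf{X}_{N+1}}\mathcal M-\nabla_{\mathbf{X}_{N+1}}(\boldsymbol\psi\mathbf b^{\mathsf T}),\qquad \boldsymbol\lambda_{v,N+1}^{(K)}=\nabla_{\mathbf{V}_{N+1}}\mathcal M-\nabla_{\mathbf{V}_{N+1}}(\boldsymbol\psi\mathbf b^{\mathsf T}),$$ $$\frac12\sum_{k=1}^K\alpha_k\sum_{i=1}^N w_i\bar{\mathcal H}_i^{(k)}=\nabla_{t_0}\mathcal M-\nabla_{t_0}(\boldsymbol\psi\mathbf b^{\mathsf T}),\qquad \frac12\sum_{k=1}^K\alpha_k\sum_{i=1}^N w_i\bar{\mathcal H}_i^{(k)}=-\nabla_{t_f}\mathcal M+\nabla_{t_f}(\boldsymbol\psi\mathbf b^{\mathsf T}).$$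
   Context: All vectors are row vectors. $N$ is the number of Legendre-Gauss (LG) points $\tau_1,\ldots,\tau_N\in(-1,1)$ (roots of the degree-$N$ Legendre polynomial), $w_1,\ldots,w_N$ are the Gauss quadrature weights, $\mathbf W=\mathrm{diag}(w_1,\ldots,w_N)$, $\tau_0=-1$, $\tau_{N+1}=+1$; $K$ is the number of mesh intervals. Let $\ell_0,\ldots,\ell_N$ be the Lagrange basis polynomials with support points $\tau_0,\ldots,\tau_N$. $\mathbf D$ is the $N\times(N+1)$ matrix $\mathbf D_{(i,j)}=\dot\ell_j(\tau_i)$, $i=1,\ldots,N$, $j=0,\ldots,N$, and $\tilde{\mathbf D}$ is the $(N+2)\times(N+1)$ matrix $\tilde{\mathbf D}_{(i,j)}=\dot\ell_j(\tau_i)$, $i=0,\ldots,N+1$, $j=0,\ldots,N$. Let $L_0,\ldots,L_{N+1}$ be the Lagrange basis polynomials with support points $\tau_0,\ldots,\tau_{N+1}$, and $\mathbf L\in\mathbb R^{(N+2)\times N}$ with $\mathbf L_{(j,i)}=\dot L_j(\tau_i)$, $j=0,\ldots,N+1$, $i=1,\ldots,N$. For a matrix $\mathbf A$, $\mathbf A_{(:,i)}$ is its column indexed $i$ and $\mathbf A_{(i,:)}$ its row indexed $i$. Data (differentiable functions): $\mathcal M(\mathbf x_0,\mathbf v_0,\mathbf x_f,\mathbf v_f,t_0,t_f)\in\mathbb R$, $\mathcal L(\mathbf x,\mathbf v,\mathbf u)\in\mathbb R$, $\mathbf f_x(\mathbf x,\mathbf v)\in\mathbb R^{n_x}$, $\mathbf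 f_v(\mathbf x,\mathbf v,\mathbf u)\in\mathbb R^{n_v}$, $\mathbf b(\mathbf x_0,\mathbf v_0,\mathbf x_f,\mathbf v_f,t_0,t_f)\in\mathbb R^{n_b}$, with $\mathbf x\in\mathbb R^{n_x}$, $\mathbf v\in\mathbb R^{n_v}$, $\mathbf u\in\mathbb R^{n_u}$. The modified LG collocation method discretizes the problem of minimizing $\mathcal M+\frac{t_f-t_0}{2}\int_{-1}^{1}\mathcal L\,dT$ subject to $d\mathbf x/dT=\frac{t_f-t_0}{2}\mathbf f_x$, $d\mathbf v/dT=\frac{t_f-t_0}{2}\mathbf f_v$, $\mathbf b=\mathbf 0$, on $K$ mesh intervals of $[-1,1]$ with scaling factors $\alpha_k>0$, $\sum_k\alpha_k=1$ (control inequality constraints are omitted). $\mathbf X_i^{(k)},\mathbf V_i^{(k)},\mathbf U_i^{(k)}$ are the discrete state and control values at $\tau_i$ in interval $k$. $\mathcal M$ and $\mathbf b$ are evaluated at $(\mathbf X_0^{(1)},\mathbf V_0^{(1)},\mathbf X_{N+1}^{(K)},\mathbf V_{N+1}^{(K)},t_0,t_f)$; $\nabla_{\mathbf X_0},\nabla_{\mathbf V_0},\nabla_{\mathbf X_{N+1}},\nabla_{\mathbf V_{N+1}},\nabla_{t_0},\nabla_{t_f}$ of $\mathcal M$ and $\boldsymbol\Psi\mathbf b^{\mathsf T}$ denote (row) gradients with respect to these six arguments. Write $\mathbf f_{x,i}^{(k)}=\mathbf f_x(\mathbf X_i^{(k)},\mathbf V_i^{(k)})$ and $\mathbf f_{v,i}^{(k)}=\mathbf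 f_v(\mathbf X_i^{(k)},\mathbf V_i^{(k)},\mathbf U_i^{(k)})$. Multipliers: $\boldsymbol\Lambda_{x,i}^{(k)}\in\mathbb R^{n_x}$, $\boldsymbol\Lambda_{v,i}^{(k)}\in\mathbb R^{n_v}$ $(i=1,\ldots,N+1)$, $\tilde{\boldsymbol\Lambda}_{v,0}^{(k)},\tilde{\boldsymbol\Lambda}_{v,N+1}^{(k)}\in\mathbb R^{n_v}$, $\boldsymbol\Psi\in\mathbb R^{n_b}$, $\Theta\in\mathbb R$. $\boldsymbol\Lambda_{x,1:N}^{(k)}$ is the $N\times n_x$ matrix with rows $\boldsymbol\Lambda_{x,1}^{(k)},\ldots,\boldsymbol\Lambda_{x,N}^{(k)}$; similarly $\boldsymbol\Lambda_{v,1:N}^{(k)}$. The discrete augmented Hamiltonian is $$\bar{\mathcal H}_i^{(k)}=\mathcal L(\mathbf X_i^{(k)},\mathbf V_i^{(k)},\mathbf U_i^{(k)})+\Big\langle\tfrac{\boldsymbol\Lambda_{x,i}^{(k)}}{w_i}+\boldsymbol\Lambda_{x,N+1}^{(k)},\mathbf f_{x,i}^{(k)}\Big\rangle+\Big\langle\tfrac{\boldsymbol\Lambda_{v,i}^{(k)}}{w_i}+\boldsymbol\Lambda_{v,N+1}^{(k)}-\mathbf L_{(0,i)}\tilde{\boldsymbol\Lambda}_{v,0}^{(k)}+\mathbf L_{(N+1,i)}\tilde{\boldsymbol\Lambda}_{v,N+1}^{(k)},\mathbf f_{v,i}^{(k)}\Big\rangle,$$ and $\nabla_{\mathbf X_i},\nabla_{\mathbf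 V_i},\nabla_{\mathbf U_i}$ of it are gradients with respect to $\mathbf X_i^{(k)},\mathbf V_i^{(k)},\mathbf U_i^{(k)}$ with multipliers held fixed. KKT conditions, for all $i=1,\ldots,N$, $k=1,\ldots,K$ ($\delta$ is the Kronecker delta; terms with coefficient $1-\delta_{1k}$ or $1-\delta_{Kk}$ are absent when the coefficient is zero): (K1) $\mathbf D_{(:,i)}^{\mathsf T}\boldsymbol\Lambda_{x,1:N}^{(k)}=\frac{t_f-t_0}{2}\alpha_k\nabla_{\mathbf X_i}(w_i\bar{\mathcal H}_i^{(k)})$; (K2) $\mathbf D_{(:,i)}^{\mathsf T}\boldsymbol\Lambda_{v,1:N}^{(k)}=\frac{t_f-t_0}{2}\alpha_k\nabla_{\mathbf V_i}(w_i\bar{\mathcal H}_i^{(k)})+\mathbf L_{(0,:)}\mathbf W\mathbf D_{(:,i)}\tilde{\boldsymbol\Lambda}_{v,0}^{(k)}-\mathbf L_{(N+1,:)}\mathbf W\mathbf D_{(:,i)}\tilde{\boldsymbol\Lambda}_{v,N+1}^{(k)}$; (K3) $\mathbf 0=\frac{t_f-t_0}{2}\alpha_k\nabla_{\mathbf U_i}(w_i\bar{\mathcal H}_i^{(k)})$; (K4) $\boldsymbol\Lambda_{x,N+1}^{(k)}-\mathbf D_{(:,0)}^{\mathsf T}\boldsymbol\Lambda_{x,1:N}^{(k)}=\delta_{1k}[-\nabla_{\mathbf X_0}\mathcal M+\nabla_{\mathbf X_0}(\boldsymbol\Psi\mathbf b^{\mathsf T})]+(1-\delta_{1k})\boldsymbol\Lambda_{x,N+1}^{(k-1)}$;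 (K5) $\boldsymbol\Lambda_{v,N+1}^{(k)}-\mathbf D_{(:,0)}^{\mathsf T}\boldsymbol\Lambda_{v,1:N}^{(k)}=\delta_{1k}[-\nabla_{\mathbf V_0}\mathcal M+\nabla_{\mathbf V_0}(\boldsymbol\Psi\mathbf b^{\mathsf T})]+(1-\delta_{1k})\boldsymbol\Lambda_{v,N+1}^{(k-1)}+\tilde{\mathbf D}_{(0,0)}\tilde{\boldsymbol\Lambda}_{v,0}^{(k)}+\tilde{\mathbf D}_{(N+1,0)}\tilde{\boldsymbol\Lambda}_{v,N+1}^{(k)}$; (K6) $\boldsymbol\Lambda_{x,N+1}^{(k)}=\delta_{Kk}[\nabla_{\mathbf X_{N+1}}\mathcal M-\nabla_{\mathbf X_{N+1}}(\boldsymbol\Psi\mathbf b^{\mathsf T})]+(1-\delta_{Kk})[\boldsymbol\Lambda_{x,N+1}^{(k+1)}-\mathbf D_{(:,0)}^{\mathsf T}\boldsymbol\Lambda_{x,1:N}^{(k+1)}]$; (K7) $\boldsymbol\Lambda_{v,N+1}^{(k)}=\delta_{Kk}[\nabla_{\mathbf V_{N+1}}\mathcal M-\nabla_{\mathbf V_{N+1}}(\boldsymbol\Psi\mathbf b^{\mathsf T})]+(1-\delta_{Kk})[\boldsymbol\Lambda_{v,N+1}^{(k+1)}-\mathbf D_{(:,0)}^{\mathsf T}\boldsymbol\Lambda_{v,1:N}^{(k+1)}-\tilde{\mathbf D}_{(0,0)}\tilde{\boldsymbol\Lambda}_{v,0}^{(k+1)}-\tilde{\mathbf D}_{(N+1,0)}\tilde{\boldsymbol\Lambda}_{v,N+1}^{(k+1)}]$;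 (K8) $\frac12\sum_{k=1}^K\alpha_k\sum_{i=1}^N w_i\bar{\mathcal H}_i^{(k)}=\nabla_{t_0}\mathcal M-\nabla_{t_0}(\boldsymbol\Psi\mathbf b^{\mathsf T})$; (K9) $\frac12\sum_{k=1}^K\alpha_k\sum_{i=1}^N w_i\bar{\mathcal H}_i^{(k)}=-\nabla_{t_f}\mathcal M+\nabla_{t_f}(\boldsymbol\Psi\mathbf b^{\mathsf T})$; (K10) $\Theta=\frac{t_f-t_0}{2}\sum_{i=1}^N w_i\bar{\mathcal H}_i^{(k)}$. *)

theory Defs
  imports "HOL-Analysis.Analysis" "HOL-Computational_Algebra.Polynomial"
begin

section \<open>Gradients\<close>

definition gradient :: "('a::real_inner \<Rightarrow> real) \<Rightarrow> 'a \<Rightarrow> 'a" where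
  "gradient f x = (THE D. GDERIV f x :> D)"

text \<open>Partial gradients of a function of the six endpoint arguments
  \<open>(x0, v0, xf, vf, t0, tf)\<close>, the remaining five arguments being held fixed.\<close>

type_synonym ('x, 'v) endpoint = "'x \<times> 'v \<times> 'x \<times> 'v \<times> real \<times> real"

definition grad_x0 ::
  "(('x::real_inner, 'v::real_inner) endpoint \<Rightarrow> real) \<Rightarrow> ('x, 'v) endpoint \<Rightarrow> 'x" where
  "grad_x0 g = (\<lambda>(x0, v0, xf, vf, t0, tf). gradient (\<lambda>y. g (y, v0, xf, vf, t0, tf)) x0)"

definition grad_v0 ::
  "(('x::real_inner, 'v::real_inner) endpoint \<Rightarrow> real) \<Rightarrow> ('x, 'v) endpoint \<Rightarrow> 'v" where
  "grad_v0 g = (\<lambda>(x0, v0, xf, vf, t0, tf). gradient (\<lambda>y. g (x0, y, xf, vf, t0, tf)) v0)"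

definition grad_xf ::
  "(('x::real_inner, 'v::real_inner) endpoint \<Rightarrow> real) \<Rightarrow> ('x, 'v) endpoint \<Rightarrow> 'x" where
  "grad_xf g = (\<lambda>(x0, v0, xf, vf, t0, tf). gradient (\<lambda>y. g (x0, v0, y, vf, t0, tf)) xf)"

definition grad_vf ::
  "(('x::real_inner, 'v::real_inner) endpoint \<Rightarrow> real) \<Rightarrow> ('x, 'v) endpoint \<Rightarrow> 'v" where
  "grad_vf g = (\<lambda>(x0, v0, xf, vf, t0, tf). gradient (\<lambda>y. g (x0, v0, xf, y, t0, tf)) vf)"

definition grad_t0 ::
  "(('x::real_inner, 'v::real_inner) endpoint \<Rightarrow> real) \<Rightarrow> ('x, 'v) endpoint \<Rightarrow> real" where
  "grad_t0 g = (\<lambda>(x0, v0, xf, vf, t0, tf). deriv (\<lambda>s. g (x0, v0, xf, vf, s, tf)) t0)"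

definition grad_tf ::
  "(('x::real_inner, 'v::real_inner) endpoint \<Rightarrow> real) \<Rightarrow> ('x, 'v) endpoint \<Rightarrow> real" where
  "grad_tf g = (\<lambda>(x0, v0, xf, vf, t0, tf). deriv (\<lambda>s. g (x0, v0, xf, vf, t0, s)) tf)"

section \<open>Legendre-Gauss points and weights\<close>

text \<open>Rodrigues' formula.\<close>

definition legendre_poly :: "nat \<Rightarrow> real poly" where
  "legendre_poly n = smult (1 / (2 ^ n * fact n)) ((pderiv ^^ n) ([:-1, 0, 1:] ^ n))"

text \<open>The points with indices \<open>1, \<dots>, N\<close> are the roots of the Legendre polynomial of degree
  \<open>N\<close> in increasing order; indices \<open>0\<close> and \<open>N + 1\<close> are the two endpoints of \<open>[-1, 1]\<close>.\<close>

definition lg_point :: "nat \<Rightarrow> nat \<Rightarrow> real" where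
  "lg_point N i =
     (if i = 0 then -1
      else if i = N + 1 then 1
      else sorted_list_of_set {t. poly (legendre_poly N) t = 0} ! (i - 1))"

text \<open>Lagrange basis polynomial for the index \<open>j \<in> S\<close> and the support points \<open>x m\<close>,
  \<open>m \<in> S\<close>.\<close>

definition lagrange_basis :: "nat set \<Rightarrow> (nat \<Rightarrow> real) \<Rightarrow> nat \<Rightarrow> real poly" where
  "lagrange_basis S x j = (\<Prod>m\<in>S - {j}. smult (1 / (x j - x m)) [:- x m, 1:])"

text \<open>The Gauss quadrature rule is the interpolatory rule on the \<open>N\<close> interior points.\<close>

definition lg_weight :: "nat \<Rightarrow> nat \<Rightarrow> real" where
  "lg_weight N i = integral {-1..1} (poly (lagrange_basis {1..N} (lg_point N) i))"

section \<open>Differentiation matrices\<close>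

text \<open>Matrices are functions of a row and a column index. The indices keep the ranges of the
  paper: \<open>D_mat N i j\<close> is used for \<open>1 \<le> i \<le> N\<close>, \<open>0 \<le> j \<le> N\<close>; \<open>Dt_mat N i j\<close> for
  \<open>0 \<le> i \<le> N + 1\<close>, \<open>0 \<le> j \<le> N\<close>; \<open>L_mat N j i\<close> for \<open>0 \<le> j \<le> N + 1\<close>, \<open>1 \<le> i \<le> N\<close>;
  \<open>D_dagger N i j\<close> for \<open>1 \<le> i \<le> N\<close>, \<open>1 \<le> j \<le> N + 1\<close>.
  \<open>D_mat\<close> and \<open>Dt_mat\<close> have the same entries and differ only in the row range.\<close>

definition Dt_mat :: "nat \<Rightarrow> nat \<Rightarrow> nat \<Rightarrow> real" where
  "Dt_mat N i j = poly (pderiv (lagrange_basis {0..N} (lg_point N) j)) (lg_point N i)"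

definition D_mat :: "nat \<Rightarrow> nat \<Rightarrow> nat \<Rightarrow> real" where
  "D_mat N i j = poly (pderiv (lagrange_basis {0..N} (lg_point N) j)) (lg_point N i)"

definition L_mat :: "nat \<Rightarrow> nat \<Rightarrow> nat \<Rightarrow> real" where
  "L_mat N j i = poly (pderiv (lagrange_basis {0..N + 1} (lg_point N) j)) (lg_point N i)"

definition D_dagger :: "nat \<Rightarrow> nat \<Rightarrow> nat \<Rightarrow> real" where
  "D_dagger N i j =
     (if j = N + 1 then \<Sum>m=1..N. lg_weight N m / lg_weight N i * D_mat N m i
      else - (lg_weight N j / lg_weight N i) * D_mat N j i)"

section \<open>Discrete augmented Hamiltonian\<close>

text \<open>The value of the Hamiltonian at node \<open>i\<close> as a function of the state and control values
  \<open>(x, v, u)\<close> there. The multipliers of the mesh interval are parameters: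
  \<open>lx i\<close>, \<open>lv i\<close> for \<open>i = 1, \<dots>, N + 1\<close>, and \<open>lv0\<close>, \<open>lvf\<close> for those with a tilde.\<close>

definition aug_hamiltonian ::
  "nat \<Rightarrow> ('x::real_inner \<times> 'v::real_inner \<times> 'u \<Rightarrow> real) \<Rightarrow> ('x \<times> 'v \<Rightarrow> 'x) \<Rightarrow> ('x \<times> 'v \<times> 'u \<Rightarrow> 'v)
   \<Rightarrow> (nat \<Rightarrow> 'x) \<Rightarrow> (nat \<Rightarrow> 'v) \<Rightarrow> 'v \<Rightarrow> 'v \<Rightarrow> nat \<Rightarrow> 'x \<Rightarrow> 'v \<Rightarrow> 'u \<Rightarrow> real" where
  "aug_hamiltonian N Lc fx fv lx lv lv0 lvf i x v u =
     Lc (x, v, u)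
     + inner (lx i /\<^sub>R lg_weight N i + lx (N + 1)) (fx (x, v))
     + inner (lv i /\<^sub>R lg_weight N i + lv (N + 1)
              - L_mat N 0 i *\<^sub>R lv0 + L_mat N (N + 1) i *\<^sub>R lvf) (fv (x, v, u))"

end

theory Submission
  imports Defs
begin

text \<open>The last column of \<open>D_dagger\<close> is chosen so that every row sums to zero. Hence
  \<open>D_dagger\<close> sees only the differences \<open>lam j - lam (N + 1)\<close>, and for the transformed adjoints
  these differences are \<open>\<Lambda> j / w j\<close> plus, for the velocity, the two correction terms with the
  rows \<open>0\<close> and \<open>N + 1\<close> of \<open>L_mat\<close> (\<open>D_dagger_sum\<close>). Off the last column \<open>D_dagger\<close> is the
  transpose of \<open>D_mat\<close>, conjugated by the weights and negated, so the factors \<open>w j\<close> cancel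
  and the row \<open>i\<close> becomes \<open>- 1 / w i\<close> times the left-hand side of the KKT condition at node
  \<open>i\<close>, with the correction terms moved to that side. On the other side a factor \<open>w i\<close> comes
  out of the gradient (\<open>gradient_cmult\<close>), since the Hamiltonian is differentiable in each
  argument. The boundary conditions are the KKT conditions at the first and last mesh
  interval in the new variables, and the time conditions carry
  over unchanged because the Hamiltonian is the same.

  What makes this legitimate is that no weight vanishes, and this is the analytic part
  (\<open>lg_weight_pos\<close>). Repeated use of Rolle's theorem on Rodrigues' formula shows that the
  Legendre polynomial of degree \<open>N\<close> has \<open>N\<close> distinct real roots, so the Gauss points are
  well defined (\<open>card_legendre_roots\<close>); repeated integration by parts shows that it is orthogonal to all polynomials of
  smaller degree (\<open>legendre_orthogonal\<close>). If \<open>l\<close> is a Lagrange basis polynomial on the Gauss points, then \<open>l * l - l\<close>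
  vanishes at all of them, so it is the Legendre polynomial times a factor of degree less than
  \<open>N\<close> and has integral zero. Thus the weight, which is the integral of \<open>l\<close>, equals the
  integral of \<open>l * l\<close> and is positive.\<close>

section \<open>Roots of the Legendre polynomials\<close>

text \<open>Rolle's theorem between consecutive elements of \<open>S\<close>. That the new roots lie strictly
  between the extreme elements of \<open>S\<close> keeps them apart from the endpoints of the interval when the
  argument is iterated.\<close>

lemma rolle_root_count:
  fixes p :: "real poly"
  assumes "finite S" "S \<noteq> {}" "\<And>x. x \<in> S \<Longrightarrow> poly p x = 0"
  shows "\<exists>T \<subseteq> {Min S<..<Max S}. finite T \<and> card T + 1 = card S
           \<and> (\<forall>x\<in>T. poly (pderiv p) x = 0)"
  using assms
proof (induction S rule: finite_linorder_max_induct)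
  case empty
  then show ?case by simp
next
  case (insert b A)
  show ?case
  proof (cases "A = {}")
    case True
    then show ?thesis by (intro exI[of _ "{}"]) auto
  next
    case False
    then obtain T where T: "T \<subseteq> {Min A<..<Max A}" "finite T" "card T + 1 = card A"
        "\<forall>x\<in>T. poly (pderiv p) x = 0"
      using insert by auto
    have MaxA: "Max A \<in> A" "Max A < b" and MinA: "Min A \<le> Max A"
      using False insert.hyps by auto
    obtain t where t: "Max A < t" "t < b" "poly (pderiv p) t = 0"
      using poly_MVT[of "Max A" b p] MaxA insert.prems by auto
    have "t \<notin> T" using T(1) t(1) by auto
    moreover have "Max (insert b A) = b" "Min (insert b A) = Min A"
      using MaxA MinA by (simp_all add: Max_insert[OF insert.hyps(1) False] Min_insert[OF insert.hyps(1) False])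
    moreover have "b \<notin> A" using insert.hyps by auto
    moreover have "Min A < t" using MinA t(1) by linarith
    ultimately show ?thesis
      using T t insert.hyps MaxA by (intro exI[of _ "insert t T"]) auto
  qed
qed

lemma power_dvd_pderiv:
  fixes p q :: "'a::{comm_semiring_1, semiring_no_zero_divisors} poly"
  assumes "p ^ Suc m dvd q"
  shows "p ^ m dvd pderiv q"
proof -
  obtain r where "q = p ^ Suc m * r" using assms by (elim dvdE)
  then have "pderiv q = p ^ m * (p * pderiv r + r * (smult (of_nat (Suc m)) (pderiv p)))"
    by (simp only: pderiv_mult pderiv_power_Suc) (simp add: algebra_simps)
  then show ?thesis by simp
qed

lemma power_dvd_higher_pderiv:
  fixes p :: "'a::{comm_semiring_1, semiring_no_zero_divisors} poly"
  assumes "k \<le> n"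
  shows "p ^ (n - k) dvd (pderiv ^^ k) (p ^ n)"
  using assms
proof (induction k)
  case (Suc k)
  then have "p ^ Suc (n - Suc k) dvd (pderiv ^^ k) (p ^ n)"
    by (simp add: Suc_diff_Suc del: power_Suc)
  then show ?case by (simp add: power_dvd_pderiv del: power_Suc)
qed simp

text \<open>The endpoints are zeros of multiplicity \<open>n\<close> of \<open>(x\<^sup>2 - 1) ^ n\<close>, and each
  differentiation lowers the multiplicity by at most one. This supplies two further zeros in each
  Rolle step and kills the boundary terms in the integration by parts.\<close>

lemma rodrigues_endpoint_zero:
  assumes "k < n" "x = -1 \<or> x = 1"
  shows "poly ((pderiv ^^ k) ([:-1, 0, 1:] ^ n)) (x::real) = 0"
proof -
  have "[:-1, 0, 1:] dvd ([:-1, 0, 1:] :: real poly) ^ (n - k)"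
    using assms by (intro dvd_power) auto
  also have "\<dots> dvd (pderiv ^^ k) ([:-1, 0, 1:] ^ n)"
    using assms by (intro power_dvd_higher_pderiv) auto
  finally show ?thesis using assms by (auto elim!: dvdE)
qed

text \<open>Together with the two endpoints, \<open>k\<close> interior roots of one derivative give \<open>k + 2\<close> points,
  hence \<open>k + 1\<close> interior roots of the next one.\<close>

lemma rodrigues_distinct_roots:
  assumes "k \<le> n"
  shows "\<exists>T \<subseteq> {-1<..<1::real}. finite T \<and> card T = k
           \<and> (\<forall>x\<in>T. poly ((pderiv ^^ k) ([:-1, 0, 1:] ^ n)) x = 0)"
  using assms
proof (induction k)
  case 0
  then show ?case by (intro exI[of _ "{}"]) auto
next
  case (Suc k)
  then obtain T where T: "T \<subseteq> {-1<..<1::real}" "finite T" "card T = k"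
      "\<forall>x\<in>T. poly ((pderiv ^^ k) ([:-1, 0, 1:] ^ n)) x = 0"
    by auto
  define S where "S = insert (-1) (insert 1 T)"
  have "card S = k + 2"
    using T unfolding S_def by (subst card_insert_disjoint; (subst card_insert_disjoint)?) auto
  moreover have fin: "finite S" "S \<noteq> {}" using T by (auto simp: S_def)
  moreover have "Min S = -1" by (rule Min_eqI[OF fin(1)]) (use T in \<open>force simp: S_def\<close>)+
  moreover have "Max S = 1" by (rule Max_eqI[OF fin(1)]) (use T in \<open>force simp: S_def\<close>)+
  moreover have "poly ((pderiv ^^ k) ([:-1, 0, 1:] ^ n)) x = 0" if "x \<in> S" for x
    using that T rodrigues_endpoint_zero[of k n x] Suc.prems by (auto simp: S_def)
  ultimately show ?case
    using rolle_root_count[of S "(pderiv ^^ k) ([:-1, 0, 1:] ^ n)"] by auto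
qed

lemma degree_higher_pderiv:
  fixes p :: "'a::{comm_semiring_1, semiring_no_zero_divisors, semiring_char_0} poly"
  shows "degree ((pderiv ^^ k) p) = degree p - k"
  by (induction k) (simp_all add: degree_pderiv)

lemma higher_pderiv_eq_0:
  fixes p :: "'a::{comm_semiring_1, semiring_no_zero_divisors, semiring_char_0} poly"
  assumes "degree p < k"
  shows "(pderiv ^^ k) p = 0"
proof -
  obtain m where k: "k = Suc m" using assms by (cases k) auto
  have "degree ((pderiv ^^ m) p) = 0" using assms k by (simp add: degree_higher_pderiv)
  then show ?thesis by (simp add: k pderiv_eq_0_iff)
qed

lemma degree_legendre: "degree (legendre_poly n) = n"
  by (simp add: legendre_poly_def degree_higher_pderiv degree_power_eq)

lemma legendre_nonzero:
  assumes "n \<ge> 1"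
  shows "legendre_poly n \<noteq> 0"
  using degree_legendre[of n] assms by force

lemma card_legendre_roots:
  assumes "n \<ge> 1"
  shows "card {t. poly (legendre_poly n) t = 0} = n"
proof (rule antisym)
  show "card {t. poly (legendre_poly n) t = 0} \<le> n"
    using card_poly_roots_bound[OF legendre_nonzero[OF assms]] by (simp add: degree_legendre)
  obtain T where T: "card T = n" "\<forall>x\<in>T. poly ((pderiv ^^ n) ([:-1, 0, 1:] ^ n)) x = (0::real)"
    using rodrigues_distinct_roots[of n n] by auto
  have "T \<subseteq> {t. poly (legendre_poly n) t = 0}" using T by (auto simp: legendre_poly_def)
  then show "n \<le> card {t. poly (legendre_poly n) t = 0}"
    using T(1) card_mono poly_roots_finite[OF legendre_nonzero[OF assms]] by blast
qed

text \<open>All roots of the Legendre polynomial are simple, so vanishing at each of them already forces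
  divisibility: the remainder has too many roots for its degree.\<close>

lemma legendre_dvd:
  assumes "n \<ge> 1" "\<And>t. poly (legendre_poly n) t = 0 \<Longrightarrow> poly r t = 0"
  shows "legendre_poly n dvd r"
proof (rule ccontr)
  let ?P = "legendre_poly n"
  assume "\<not> ?P dvd r"
  then have nz: "r mod ?P \<noteq> 0" by (simp add: dvd_eq_mod_eq_0)
  have "{t. poly ?P t = 0} \<subseteq> {t. poly (r mod ?P) t = 0}"
  proof clarify
    fix t assume t: "poly ?P t = 0"
    have "poly r t = poly (r div ?P) t * poly ?P t + poly (r mod ?P) t"
      by (metis div_mult_mod_eq poly_add poly_mult)
    then show "poly (r mod ?P) t = 0" using assms(2)[OF t] t by simp
  qed
  then have "n \<le> card {t. poly (r mod ?P) t = 0}"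
    using card_mono[OF poly_roots_finite[OF nz]] card_legendre_roots[OF assms(1)] by metis
  also have "\<dots> \<le> degree (r mod ?P)" by (rule card_poly_roots_bound[OF nz])
  also have "\<dots> < n" using degree_mod_less'[OF legendre_nonzero[OF assms(1)] nz] by (simp add: degree_legendre)
  finally show False by simp
qed

section \<open>Orthogonality of the Legendre polynomials\<close>

lemma integrable_poly: "poly (p::real poly) integrable_on {a..b}"
  by (intro integrable_continuous_real continuous_intros)

lemma integral_pderiv:
  fixes p :: "real poly"
  assumes "a \<le> b"
  shows "integral {a..b} (poly (pderiv p)) = poly p b - poly p a"
  using assms
  by (intro integral_unique fundamental_theorem_of_calculus)
     (auto simp flip: has_real_derivative_iff_has_vector_derivative
           intro: DERIV_subset[OF poly_DERIV])

text \<open>Integration by parts \<open>k\<close> times.\<close>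

lemma integral_higher_pderiv_mult:
  fixes p q :: "real poly"
  assumes "a \<le> b" "\<And>j. j < k \<Longrightarrow> poly ((pderiv ^^ j) p) a = 0 \<and> poly ((pderiv ^^ j) p) b = 0"
  shows "integral {a..b} (poly ((pderiv ^^ k) p * q))
           = (-1) ^ k * integral {a..b} (poly (p * (pderiv ^^ k) q))"
  using assms(2)
proof (induction k arbitrary: q)
  case (Suc k)
  let ?r = "(pderiv ^^ k) p"
  have "integral {a..b} (poly (pderiv (?r * q))) = 0"
    using Suc.prems[of k] assms(1) by (simp add: integral_pderiv)
  moreover have "poly (pderiv (?r * q)) = (\<lambda>x. poly (?r * pderiv q) x + poly (pderiv ?r * q) x)"
    by (auto simp: pderiv_mult algebra_simps)
  ultimately have "integral {a..b} (poly (pderiv ?r * q)) = - integral {a..b} (poly (?r * pderiv q))"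
    by (simp add: integral_add integrable_poly del: poly_mult)
  also have "\<dots> = (-1) ^ Suc k * integral {a..b} (poly (p * (pderiv ^^ Suc k) q))"
    using Suc.IH[of "pderiv q"] Suc.prems by (simp add: funpow_swap1 del: poly_mult)
  finally show ?case by (simp del: poly_mult)
qed simp

lemma legendre_orthogonal:
  assumes "degree q < n"
  shows "integral {-1..1} (poly (legendre_poly n * q)) = 0"
proof -
  let ?c = "1 / (2 ^ n * fact n) :: real"
  let ?r = "(pderiv ^^ n) ([:-1, 0, 1:] ^ n) :: real poly"
  have "poly 0 = (\<lambda>_. 0 :: real)" by auto
  then have "integral {-1..1} (poly (?r * q)) = 0"
    by (subst integral_higher_pderiv_mult)
       (auto simp: rodrigues_endpoint_zero higher_pderiv_eq_0[OF assms])
  moreover have "poly (legendre_poly n * q) = (\<lambda>x. ?c * poly (?r * q) x)"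
    by (auto simp: legendre_poly_def)
  ultimately show ?thesis by (simp only: integral_mult_right mult_zero_right)
qed

section \<open>Positivity of the Gauss weights\<close>

lemma lg_point_bij:
  assumes "N \<ge> 1"
  shows "bij_betw (lg_point N) {1..N} {t. poly (legendre_poly N) t = 0}"
proof -
  let ?R = "{t. poly (legendre_poly N) t = 0}"
  have fin: "finite ?R" by (rule poly_roots_finite[OF legendre_nonzero[OF assms]])
  have "bij_betw (\<lambda>i. i - 1) {1..N} {..<N}"
    by (rule bij_betw_byWitness[where f' = Suc]) auto
  moreover have "bij_betw ((!) (sorted_list_of_set ?R)) {..<N} ?R"
    by (rule bij_betw_nth) (auto simp: fin card_legendre_roots[OF assms])
  ultimately have "bij_betw ((!) (sorted_list_of_set ?R) \<circ> (\<lambda>i. i - 1)) {1..N} ?R"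
    by (rule bij_betw_trans)
  then show ?thesis
    by (subst bij_betw_cong) (auto simp: lg_point_def)
qed

lemma poly_lagrange_basis_node:
  assumes "finite S" "inj_on x S" "i \<in> S" "j \<in> S"
  shows "poly (lagrange_basis S x i) (x j) = (if i = j then 1 else 0)"
proof (cases "i = j")
  case True
  have "poly (lagrange_basis S x i) (x i) = 1"
    unfolding lagrange_basis_def poly_prod
  proof (intro prod.neutral ballI)
    fix m assume "m \<in> S - {i}"
    then have "x i - x m \<noteq> 0" using assms by (auto simp: inj_on_def)
    then show "poly (smult (1 / (x i - x m)) [:- x m, 1:]) (x i) = 1"
      by (simp flip: diff_divide_distrib)
  qed
  then show ?thesis using True by simp
next
  case False
  then show ?thesis using assms
    by (auto simp: lagrange_basis_def poly_prod intro!: prod_zero bexI[of _ j])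
qed

lemma degree_lagrange_basis_le:
  assumes "finite S" "i \<in> S"
  shows "degree (lagrange_basis S x i) \<le> card S - 1"
proof -
  have "degree (lagrange_basis S x i) \<le> (\<Sum>m\<in>S - {i}. degree (smult (1 / (x i - x m)) [:- x m, 1:]))"
    unfolding lagrange_basis_def using degree_prod_sum_le[of "S - {i}"] assms(1)
    unfolding o_def by blast
  also have "\<dots> \<le> (\<Sum>m\<in>S - {i}. 1)" by (intro sum_mono) auto
  finally show ?thesis using assms by simp
qed

lemma integral_poly_square_pos:
  fixes p :: "real poly"
  assumes "p \<noteq> 0" "a < b"
  shows "integral {a..b} (poly (p * p)) > 0"
proof -
  have "integral {a..b} (poly (p * p)) \<noteq> 0"
  proof
    assume "integral {a..b} (poly (p * p)) = 0"
    then have "\<forall>x\<in>{a..b}. poly (p * p) x = 0"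
      using assms by (subst (asm) integral_eq_0_iff) (auto intro!: continuous_intros)
    then have "{a..b} \<subseteq> {x. poly p x = 0}" by auto
    then have "finite {a..b}" using poly_roots_finite[OF assms(1)] finite_subset by blast
    then show False using assms(2) infinite_Icc by blast
  qed
  moreover have "integral {a..b} (poly (p * p)) \<ge> 0"
    by (intro integral_nonneg integrable_poly) auto
  ultimately show ?thesis by linarith
qed

text \<open>The rule with \<open>N\<close> Gauss points is exact up to degree \<open>2 * N - 1\<close>; applied to the square of
  a Lagrange basis polynomial, of degree \<open>2 * N - 2\<close>, it returns the weight.\<close>

lemma lg_weight_pos:
  assumes "i \<in> {1..N}"
  shows "lg_weight N i > 0"
proof -
  have N: "N \<ge> 1" using assms by auto
  let ?l = "lagrange_basis {1..N} (lg_point N) i"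
  note bij = lg_point_bij[OF N]
  have node: "poly ?l (lg_point N j) = (if i = j then 1 else 0)" if "j \<in> {1..N}" for j
    using that assms bij by (intro poly_lagrange_basis_node) (auto simp: bij_betw_def)
  have nz: "?l \<noteq> 0" using node[OF assms] by auto
  have "legendre_poly N dvd ?l * ?l - ?l"
  proof (rule legendre_dvd[OF N])
    fix t assume "poly (legendre_poly N) t = 0"
    then obtain j where "j \<in> {1..N}" "t = lg_point N j"
      using bij unfolding bij_betw_def by blast
    then show "poly (?l * ?l - ?l) t = 0" by (simp only: poly_diff poly_mult node) simp
  qed
  then obtain q where q: "?l * ?l - ?l = legendre_poly N * q" by (elim dvdE)
  have "degree q < N"
  proof (cases "q = 0")
    case False
    have "N + degree q = degree (?l * ?l - ?l)"
      unfolding q using False legendre_nonzero[OF N] by (simp add: degree_mult_eq degree_legendre)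
    also have "\<dots> \<le> 2 * (N - 1)"
      using degree_lagrange_basis_le[of "{1..N}" i "lg_point N"] assms
        degree_mult_le[of ?l ?l] by (intro degree_diff_le) auto
    finally show ?thesis using N by linarith
  qed (use N in auto)
  then have "integral {-1..1} (poly (?l * ?l - ?l)) = 0"
    unfolding q by (rule legendre_orthogonal)
  moreover have "poly (?l * ?l - ?l) = (\<lambda>x. poly (?l * ?l) x - poly ?l x)" by auto
  ultimately have "integral {-1..1} (poly (?l * ?l)) = lg_weight N i"
    by (simp add: lg_weight_def integral_diff integrable_poly del: poly_mult)
  then show ?thesis using integral_poly_square_pos[OF nz, of "-1" 1] by simp
qed

section \<open>Gradients\<close>

lemma gradient_eqI:
  assumes "GDERIV f x :> D"
  shows "gradient f x = D"
  unfolding gradient_def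
proof (rule the_equality)
  show "GDERIV f x :> D" by (rule assms)
  fix D' assume "GDERIV f x :> D'"
  then have "(\<lambda>h. inner h D') = (\<lambda>h. inner h D)"
    using assms has_derivative_unique unfolding gderiv_def by blast
  then show "D' = D" by (metis vector_eq_ldot)
qed

text \<open>Differentiability guarantees, by way of the Riesz representation of the derivative, that the
  definite description in \<open>gradient\<close> denotes the actual gradient.\<close>

lemma gradient_cmult:
  fixes f :: "'a::euclidean_space \<Rightarrow> real"
  assumes "f differentiable at x"
  shows "gradient (\<lambda>y. c * f y) x = c *\<^sub>R gradient f x"
proof -
  obtain f' where f': "(f has_derivative f') (at x)"
    using assms by (auto simp: differentiable_def)
  have "f' = (\<lambda>h. inner h (adjoint f' 1))"
    using adjoint_works[OF has_derivative_linear[OF f']] by auto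
  then have D: "GDERIV f x :> adjoint f' 1" using f' by (simp add: gderiv_def)
  have "GDERIV (\<lambda>y. c * f y) x :> c *\<^sub>R adjoint f' 1"
    using has_derivative_mult_right[OF D[unfolded gderiv_def], of c] by (simp add: gderiv_def)
  then show ?thesis using gradient_eqI[OF D] by (simp add: gradient_eqI)
qed

lemma aug_hamiltonian_differentiable:
  fixes Lc :: "'x::euclidean_space \<times> 'v::euclidean_space \<times> 'u::euclidean_space \<Rightarrow> real"
    and N i :: nat and lx :: "nat \<Rightarrow> 'x" and lv :: "nat \<Rightarrow> 'v" and lv0 lvf :: 'v
  assumes "Lc differentiable_on UNIV" "fx differentiable_on UNIV" "fv differentiable_on UNIV"
  defines "h \<equiv> aug_hamiltonian N Lc fx fv lx lv lv0 lvf i"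
  shows "(\<lambda>x. h x v u) differentiable at x"
    and "(\<lambda>v. h x v u) differentiable at v"
    and "(\<lambda>u. h x v u) differentiable at u"
proof -
  have *: "f differentiable at z" if "f differentiable_on UNIV"
    for f :: "'p::euclidean_space \<Rightarrow> 'q::euclidean_space" and z
    using that by (simp add: differentiable_on_def)
  have pair: "(\<lambda>y. (f y, g y)) differentiable at z" if "f differentiable at z" "g differentiable at z"
    for f :: "'p::euclidean_space \<Rightarrow> 'q::euclidean_space"
      and g :: "'p::euclidean_space \<Rightarrow> 'r::euclidean_space" and z
    using that has_derivative_Pair unfolding differentiable_def by blast
  have comp: "(\<lambda>y. f (g y)) differentiable at z" if "f differentiable_on UNIV" "g differentiable at z"
    for f :: "'q::euclidean_space \<Rightarrow> 'r::euclidean_space"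
      and g :: "'p::euclidean_space \<Rightarrow> 'q::euclidean_space" and z
    using differentiable_chain_at[OF that(2) *[OF that(1)]] by (simp add: o_def)
  show "(\<lambda>x. h x v u) differentiable at x" "(\<lambda>v. h x v u) differentiable at v"
    "(\<lambda>u. h x v u) differentiable at u"
    unfolding h_def aug_hamiltonian_def
    by (intro differentiable_add differentiable_inner differentiable_const
          comp[OF assms(1)] comp[OF assms(2)] comp[OF assms(3)] pair differentiable_ident)+
qed

section \<open>The transformed adjoint system\<close>

text \<open>The rows of \<open>D_dagger\<close> sum to zero, so a constant may be subtracted from \<open>lam\<close>; the value at
  \<open>N + 1\<close> is subtracted because it removes the last column.\<close>

lemma D_dagger_sum:
  fixes lam :: "nat \<Rightarrow> 'a::real_vector"
  shows "(\<Sum>j=1..N+1. D_dagger N i j *\<^sub>R lam j)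
    = - (1 / lg_weight N i) *\<^sub>R (\<Sum>j=1..N. D_mat N j i *\<^sub>R (lg_weight N j *\<^sub>R (lam j - lam (N + 1))))"
  by (simp add: D_dagger_def scaleR_sum_left scaleR_sum_right sum_subtractf sum_negf
        scaleR_diff_right mult_ac)

theorem mainTheorem1:
  fixes N K :: nat
    and M :: "(real ^ 'nx, real ^ 'nv) endpoint \<Rightarrow> real"
    and Lc :: "(real ^ 'nx) \<times> (real ^ 'nv) \<times> (real ^ 'nu) \<Rightarrow> real"
    and fx :: "(real ^ 'nx) \<times> (real ^ 'nv) \<Rightarrow> real ^ 'nx"
    and fv :: "(real ^ 'nx) \<times> (real ^ 'nv) \<times> (real ^ 'nu) \<Rightarrow> real ^ 'nv"
    and b :: "(real ^ 'nx, real ^ 'nv) endpoint \<Rightarrow> real ^ 'nb"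
    and X :: "nat \<Rightarrow> nat \<Rightarrow> real ^ 'nx" and V :: "nat \<Rightarrow> nat \<Rightarrow> real ^ 'nv"
    and U :: "nat \<Rightarrow> nat \<Rightarrow> real ^ 'nu"
    and t0 tf :: real and \<alpha> :: "nat \<Rightarrow> real"
    and \<Lambda>x :: "nat \<Rightarrow> nat \<Rightarrow> real ^ 'nx" and \<Lambda>v :: "nat \<Rightarrow> nat \<Rightarrow> real ^ 'nv"
    and \<Lambda>v0 \<Lambda>vf :: "nat \<Rightarrow> real ^ 'nv"
    and \<Psi> :: "real ^ 'nb" and \<Theta> :: real
    and D Dt L Dd :: "nat \<Rightarrow> nat \<Rightarrow> real" and w :: "nat \<Rightarrow> real"
    and H :: "nat \<Rightarrow> nat \<Rightarrow> real ^ 'nx \<Rightarrow> real ^ 'nv \<Rightarrow> real ^ 'nu \<Rightarrow> real"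
    and e :: "(real ^ 'nx, real ^ 'nv) endpoint"
    and lam_x :: "nat \<Rightarrow> nat \<Rightarrow> real ^ 'nx" and lam_v :: "nat \<Rightarrow> nat \<Rightarrow> real ^ 'nv"
    and \<psi> :: "real ^ 'nb"
  assumes N: "N \<ge> 1" and K: "K \<ge> 1"
    and diff: "M differentiable_on UNIV" "Lc differentiable_on UNIV" "fx differentiable_on UNIV"
      "fv differentiable_on UNIV" "b differentiable_on UNIV"
    and alpha: "\<And>k. k \<in> {1..K} \<Longrightarrow> \<alpha> k > 0" "(\<Sum>k=1..K. \<alpha> k) = 1"
    and mats: "w = lg_weight N" "D = D_mat N" "Dt = Dt_mat N" "L = L_mat N" "Dd = D_dagger N"
    and H: "H = (\<lambda>k. aug_hamiltonian N Lc fx fv (\<Lambda>x k) (\<Lambda>v k) (\<Lambda>v0 k) (\<Lambda>vf k))"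
    and e: "e = (X 1 0, V 1 0, X K (N + 1), V K (N + 1), t0, tf)"
    and K1: "\<And>i k. i \<in> {1..N} \<Longrightarrow> k \<in> {1..K} \<Longrightarrow>
      (\<Sum>j=1..N. D j i *\<^sub>R \<Lambda>x k j)
        = ((tf - t0) / 2 * \<alpha> k) *\<^sub>R gradient (\<lambda>x. w i * H k i x (V k i) (U k i)) (X k i)"
    and K2: "\<And>i k. i \<in> {1..N} \<Longrightarrow> k \<in> {1..K} \<Longrightarrow>
      (\<Sum>j=1..N. D j i *\<^sub>R \<Lambda>v k j)
        = ((tf - t0) / 2 * \<alpha> k) *\<^sub>R gradient (\<lambda>v. w i * H k i (X k i) v (U k i)) (V k i)
          + (\<Sum>j=1..N. L 0 j * w j * D j i) *\<^sub>R \<Lambda>v0 k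
          - (\<Sum>j=1..N. L (N + 1) j * w j * D j i) *\<^sub>R \<Lambda>vf k"
    and K3: "\<And>i k. i \<in> {1..N} \<Longrightarrow> k \<in> {1..K} \<Longrightarrow>
      0 = ((tf - t0) / 2 * \<alpha> k) *\<^sub>R gradient (\<lambda>u. w i * H k i (X k i) (V k i) u) (U k i)"
    and K4: "\<And>k. k \<in> {1..K} \<Longrightarrow>
      \<Lambda>x k (N + 1) - (\<Sum>j=1..N. D j 0 *\<^sub>R \<Lambda>x k j)
        = (if k = 1 then - grad_x0 M e + grad_x0 (\<lambda>y. inner \<Psi> (b y)) e else \<Lambda>x (k - 1) (N + 1))"
    and K5: "\<And>k. k \<in> {1..K} \<Longrightarrow>
      \<Lambda>v k (N + 1) - (\<Sum>j=1..N. D j 0 *\<^sub>R \<Lambda>v k j)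
        = (if k = 1 then - grad_v0 M e + grad_v0 (\<lambda>y. inner \<Psi> (b y)) e else \<Lambda>v (k - 1) (N + 1))
          + Dt 0 0 *\<^sub>R \<Lambda>v0 k + Dt (N + 1) 0 *\<^sub>R \<Lambda>vf k"
    and K6: "\<And>k. k \<in> {1..K} \<Longrightarrow>
      \<Lambda>x k (N + 1)
        = (if k = K then grad_xf M e - grad_xf (\<lambda>y. inner \<Psi> (b y)) e
           else \<Lambda>x (k + 1) (N + 1) - (\<Sum>j=1..N. D j 0 *\<^sub>R \<Lambda>x (k + 1) j))"
    and K7: "\<And>k. k \<in> {1..K} \<Longrightarrow>
      \<Lambda>v k (N + 1)
        = (if k = K then grad_vf M e - grad_vf (\<lambda>y. inner \<Psi> (b y)) e
           else \<Lambda>v (k + 1) (N + 1) - (\<Sum>j=1..N. D j 0 *\<^sub>R \<Lambda>v (k + 1) j)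
                - Dt 0 0 *\<^sub>R \<Lambda>v0 (k + 1) - Dt (N + 1) 0 *\<^sub>R \<Lambda>vf (k + 1))"
    and K8: "1 / 2 * (\<Sum>k=1..K. \<alpha> k * (\<Sum>i=1..N. w i * H k i (X k i) (V k i) (U k i)))
        = grad_t0 M e - grad_t0 (\<lambda>y. inner \<Psi> (b y)) e"
    and K9: "1 / 2 * (\<Sum>k=1..K. \<alpha> k * (\<Sum>i=1..N. w i * H k i (X k i) (V k i) (U k i)))
        = - grad_tf M e + grad_tf (\<lambda>y. inner \<Psi> (b y)) e"
    and K10: "\<And>k. k \<in> {1..K} \<Longrightarrow>
      \<Theta> = (tf - t0) / 2 * (\<Sum>i=1..N. w i * H k i (X k i) (V k i) (U k i))"
    and lam_x_0: "\<And>k. k \<in> {1..K} \<Longrightarrow>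
      lam_x k 0 = \<Lambda>x k (N + 1) - (\<Sum>j=1..N. D j 0 *\<^sub>R \<Lambda>x k j)"
    and lam_x_i: "\<And>i k. i \<in> {1..N} \<Longrightarrow> k \<in> {1..K} \<Longrightarrow>
      lam_x k i = (1 / w i) *\<^sub>R \<Lambda>x k i + \<Lambda>x k (N + 1)"
    and lam_x_f: "\<And>k. k \<in> {1..K} \<Longrightarrow> lam_x k (N + 1) = \<Lambda>x k (N + 1)"
    and lam_v_0: "\<And>k. k \<in> {1..K} \<Longrightarrow>
      lam_v k 0 = \<Lambda>v k (N + 1) - (\<Sum>j=1..N. D j 0 *\<^sub>R \<Lambda>v k j)
                  - Dt 0 0 *\<^sub>R \<Lambda>v0 k - Dt (N + 1) 0 *\<^sub>R \<Lambda>vf k"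
    and lam_v_i: "\<And>i k. i \<in> {1..N} \<Longrightarrow> k \<in> {1..K} \<Longrightarrow>
      lam_v k i = (1 / w i) *\<^sub>R \<Lambda>v k i + \<Lambda>v k (N + 1) - L 0 i *\<^sub>R \<Lambda>v0 k + L (N + 1) i *\<^sub>R \<Lambda>vf k"
    and lam_v_f: "\<And>k. k \<in> {1..K} \<Longrightarrow> lam_v k (N + 1) = \<Lambda>v k (N + 1)"
    and psi: "\<psi> = \<Psi>"
  shows "(\<forall>i\<in>{1..N}. \<forall>k\<in>{1..K}.
           (\<Sum>j=1..N+1. Dd i j *\<^sub>R lam_x k j)
             = - (((tf - t0) / 2 * \<alpha> k) *\<^sub>R gradient (\<lambda>x. H k i x (V k i) (U k i)) (X k i))
         \<and> (\<Sum>j=1..N+1. Dd i j *\<^sub>R lam_v k j)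
             = - (((tf - t0) / 2 * \<alpha> k) *\<^sub>R gradient (\<lambda>v. H k i (X k i) v (U k i)) (V k i))
         \<and> 0 = ((tf - t0) / 2 * \<alpha> k) *\<^sub>R gradient (\<lambda>u. H k i (X k i) (V k i) u) (U k i))
    \<and> lam_x 1 0 = - grad_x0 M e + grad_x0 (\<lambda>y. inner \<psi> (b y)) e
    \<and> lam_v 1 0 = - grad_v0 M e + grad_v0 (\<lambda>y. inner \<psi> (b y)) e
    \<and> lam_x K (N + 1) = grad_xf M e - grad_xf (\<lambda>y. inner \<psi> (b y)) e
    \<and> lam_v K (N + 1) = grad_vf M e - grad_vf (\<lambda>y. inner \<psi> (b y)) e
    \<and> 1 / 2 * (\<Sum>k=1..K. \<alpha> k * (\<Sum>i=1..N. w i * H k i (X k i) (V k i) (U k i)))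
        = grad_t0 M e - grad_t0 (\<lambda>y. inner \<psi> (b y)) e
    \<and> 1 / 2 * (\<Sum>k=1..K. \<alpha> k * (\<Sum>i=1..N. w i * H k i (X k i) (V k i) (U k i)))
        = - grad_tf M e + grad_tf (\<lambda>y. inner \<psi> (b y)) e"
proof -
  have w: "w i > 0" if "i \<in> {1..N}" for i
    using lg_weight_pos[OF that] mats by simp
  note H_diff = aug_hamiltonian_differentiable[OF diff(2-4)]
  have dagger: "(\<Sum>j=1..N+1. Dd i j *\<^sub>R lam j)
      = - (1 / w i) *\<^sub>R (\<Sum>j=1..N. D j i *\<^sub>R (w j *\<^sub>R (lam j - lam (N + 1))))"
    for i and lam :: "nat \<Rightarrow> real ^ 'n"
    using D_dagger_sum mats by simp
  have x_eq: "(\<Sum>j=1..N+1. Dd i j *\<^sub>R lam_x k j)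
      = - (((tf - t0) / 2 * \<alpha> k) *\<^sub>R gradient (\<lambda>x. H k i x (V k i) (U k i)) (X k i))"
    if ik: "i \<in> {1..N}" "k \<in> {1..K}" for i k
  proof -
    have "(\<Sum>j=1..N. D j i *\<^sub>R (w j *\<^sub>R (lam_x k j - lam_x k (N + 1)))) = (\<Sum>j=1..N. D j i *\<^sub>R \<Lambda>x k j)"
    proof (rule sum.cong[OF refl])
      fix j assume j: "j \<in> {1..N}"
      show "D j i *\<^sub>R (w j *\<^sub>R (lam_x k j - lam_x k (N + 1))) = D j i *\<^sub>R \<Lambda>x k j"
        using w[OF j] by (simp only: lam_x_i[OF j ik(2)] lam_x_f[OF ik(2)]) simp
    qed
    also have "\<dots> = w i *\<^sub>R (((tf - t0) / 2 * \<alpha> k) *\<^sub>R gradient (\<lambda>x. H k i x (V k i) (U k i)) (X k i))"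
      by (simp only: K1[OF ik]) (simp add: gradient_cmult H_diff(1) H mult_ac)
    finally show ?thesis using w[OF ik(1)] by (simp only: dagger) simp
  qed
  have v_eq: "(\<Sum>j=1..N+1. Dd i j *\<^sub>R lam_v k j)
      = - (((tf - t0) / 2 * \<alpha> k) *\<^sub>R gradient (\<lambda>v. H k i (X k i) v (U k i)) (V k i))"
    if ik: "i \<in> {1..N}" "k \<in> {1..K}" for i k
  proof -
    have "(\<Sum>j=1..N. D j i *\<^sub>R (w j *\<^sub>R (lam_v k j - lam_v k (N + 1))))
        = (\<Sum>j=1..N. D j i *\<^sub>R \<Lambda>v k j - (L 0 j * w j * D j i) *\<^sub>R \<Lambda>v0 k
            + (L (N + 1) j * w j * D j i) *\<^sub>R \<Lambda>vf k)"
    proof (rule sum.cong[OF refl])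
      fix j assume j: "j \<in> {1..N}"
      show "D j i *\<^sub>R (w j *\<^sub>R (lam_v k j - lam_v k (N + 1)))
          = D j i *\<^sub>R \<Lambda>v k j - (L 0 j * w j * D j i) *\<^sub>R \<Lambda>v0 k
            + (L (N + 1) j * w j * D j i) *\<^sub>R \<Lambda>vf k"
        using w[OF j] by (simp only: lam_v_i[OF j ik(2)] lam_v_f[OF ik(2)])
          (simp add: scaleR_diff_right scaleR_add_right mult_ac)
    qed
    also have "\<dots> = (\<Sum>j=1..N. D j i *\<^sub>R \<Lambda>v k j) - (\<Sum>j=1..N. L 0 j * w j * D j i) *\<^sub>R \<Lambda>v0 k
        + (\<Sum>j=1..N. L (N + 1) j * w j * D j i) *\<^sub>R \<Lambda>vf k"
      by (simp only: sum.distrib sum_subtractf scaleR_sum_left)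
    also have "\<dots> = w i *\<^sub>R (((tf - t0) / 2 * \<alpha> k) *\<^sub>R gradient (\<lambda>v. H k i (X k i) v (U k i)) (V k i))"
      by (simp only: K2[OF ik]) (simp add: gradient_cmult H_diff(2) H mult_ac)
    finally show ?thesis using w[OF ik(1)] by (simp only: dagger) simp
  qed
  have u_eq: "0 = ((tf - t0) / 2 * \<alpha> k) *\<^sub>R gradient (\<lambda>u. H k i (X k i) (V k i) u) (U k i)"
    if ik: "i \<in> {1..N}" "k \<in> {1..K}" for i k
    using K3[OF ik] w[OF ik(1)] by (simp add: gradient_cmult H_diff(3) H)
  have k1: "1 \<in> {1..K}" and kK: "K \<in> {1..K}" using K by auto
  have "lam_x 1 0 = - grad_x0 M e + grad_x0 (\<lambda>y. inner \<psi> (b y)) e"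
    using K4[OF k1] lam_x_0[OF k1] psi by simp
  moreover have "lam_v 1 0 = - grad_v0 M e + grad_v0 (\<lambda>y. inner \<psi> (b y)) e"
    using K5[OF k1] lam_v_0[OF k1] psi by simp
  moreover have "lam_x K (N + 1) = grad_xf M e - grad_xf (\<lambda>y. inner \<psi> (b y)) e"
    using K6[OF kK] lam_x_f[OF kK] psi by simp
  moreover have "lam_v K (N + 1) = grad_vf M e - grad_vf (\<lambda>y. inner \<psi> (b y)) e"
    using K7[OF kK] lam_v_f[OF kK] psi by simp
  ultimately show ?thesis using x_eq v_eq u_eq K8 K9 psi by blast
qed

end
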